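(* Let $y\in Y^D$ be such that $\mathcal A(x)=y$ has at least one solution, let $x_0\in X^B$ and $\tau>1$, and let an admissible step size selection that is continuous at $\delta=0$ be given (see context). Let $(\delta_j)_{j\in\mathbb N}$ be a sequence in $(0,\infty)$ converging to $0$ and let $(y_j)_{j\in\mathbb N}$ be a sequence of noisy data in $Y^D$ with $\|\mathcal Q^Y_b(y_j-y)\|\le\delta_j$ for all $b\in\{1,\dots,B\}$ and all $j$. For each $j$ let $(x_{j,k})_{k\in\mathbb N}$ be the loping BCD iterates with data $y_j$ and noise level $\delta_j$ (started at $x_{j,0}=x_0$), and let $k_j:=k_*(\delta_j,y_j)$ be the corresponding stopping index, where $k_*(\delta,y^\delta)=\min\{k\in\mathbb N: x_k^\delta=x_{k+1}^\delta=\dots=x_{k+p-1}^\delta\}$. Then $x_{j,k_j}\to x^+$ in norm as $j\to\infty$, where $x^+$ is the solution of $\mathcal A(x)=y$ with minimal distance to $x_0$.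
   Context: $\mathbb N=\{0,1,2,\dots\}$. $X,Y$ are real Hilbert spaces, $B,D\ge 1$ integers, and $X^B$, $X^D$, $Y^D$ carry the product Hilbert space structure. $K\colon X\to Y$ is bounded linear, and $V=(V_{d,b})\in\mathbb R^{D\times B}$ is a matrix of rank $B$ with (nonzero) columns $v_1,\dots,v_B\in\mathbb R^D$. The forward operator is $\mathcal A=V\otimes K\colon X^B\to Y^D$, i.e. $(\mathcal A x)[d]=\sum_{b=1}^B V_{d,b}K(x[b])$; $\mathcal A^*$ is its adjoint. $\mathcal V_X=V\otimes \mathrm{Id}_X\colon X^B\to X^D$, $(\mathcal V_X x)[d]=\sum_{b}V_{d,b}\,x[b]$. For $b\in\{1,\dots,B\}$, $\mathcal P_b\colon X^B\to X^B$ keeps the $b$-th block and sets all other blocks to $0$. $\mathcal Q^Y_b=\|v_b\|^{-2}(v_bv_b^{\mathsf T})\otimes \mathrm{Id}_Y\colon Y^D\to Y^D$, which is an orthogonal projection. The control $b\colon\mathbb N\to\{1,\dots,B\}$ and the integer $p\ge1$ satisfy: for all $k\in\mathbb N$, $\{b(k),\dots,b(k+p-1)\}=\{1,\dots,B\}$. This same $p$ appears in the stopping index. Loping BCD (block coordinate descent): for $\delta\ge0$ and data $y^\delta\in Y^D$ with $\|\mathcal Q^Y_b(y-y^\delta)\|\le\delta$ for all $b$, put $x_0^\delta=x_0$ and $$x_{k+1}^\delta=x_k^\delta-d_k^\delta s_k^\delta\,\mathcal P_{b(k)}\mathcal A^*(\mathcal A(x_k^\delta)-y^\delta),$$ where $r_k^\delta=\|\mathcal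 Q^Y_{b(k)}(y^\delta-\mathcal A(x_k^\delta))\|$, and $d_k^\delta=1$ if $r_k^\delta\ge\tau\delta$, $d_k^\delta=0$ otherwise. For $\delta=0$ (where the data are taken to be $y$ itself) one has $d_k=1$ and writes $x_k,s_k$. Step size selection: a rule assigning to every pair $(\delta,y^\delta)$ with $\delta\ge0$, $y^\delta\in Y^D$ and $\|\mathcal Q^Y_b(y-y^\delta)\|\le\delta$ for all $b\in\{1,\dots,B\}$ (with $y^0=y$ when $\delta=0$) step sizes $s_k^\delta=s_k^\delta(y^\delta)$, $k\in\mathbb N$. It is admissible if there are constants $0<s_{\min}\le s_{\max}$ and $\theta_{\max}<2$, independent of $k$, $\delta$, $y^\delta$, such that $s_{\min}\le s_k^\delta\le s_{\max}$ always, and whenever $d_k^\delta=1$ one has $s_k^\delta\in(0,2A_k^\delta)$ and $s_k^\delta/A_k^\delta\le\theta_{\max}$, where $$A_k^\delta=\frac{\|v_{b(k)}\|^2\,r_k^\delta(r_k^\delta-\delta)}{\|\mathcal V_X\mathcal P_{b(k)}\mathcal A^*(y^\delta-\mathcal A(x_k^\delta))\|^2}$$ (with $A_k^\delta=+\infty$ and $s_k^\delta/A_k^\delta=0$ if the denominator is $0$). It is continuous at $\delta=0$ if for all $k\in\mathbb N$, $\lim_{\delta\to0}\sup\{|s_k^\delta(y^\delta)-s_k|: y^\delta\in Y^D,\ \|y-y^\delta\|\le\delta\}=0$.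
   Formalization: The stopping index is taken as min{k : x_k = x_{k+1} = … = x_{k+p}} (p idle updates) instead of … = x_{k+p-1}; with only p-1 idle updates the claim is false, e.g. for B = p = 1, where the condition is void and k_* = 0 always. *)

theory Defs
  imports "HOL-Analysis.Analysis"
begin

text \<open>The product space of \<open>'b\<close>-indexed families over \<open>'x\<close> is the type \<open>'x ^ 'b\<close>, whose inner product is
  the sum of the componentwise ones. The finite types \<open>'b\<close> and \<open>'d\<close> replace the index sets of
  cardinality \<open>B\<close> and \<open>D\<close>.\<close>

definition tensor_op ::
    "real ^ 'b ^ 'd \<Rightarrow> ('x::real_vector \<Rightarrow> 'y::real_vector) \<Rightarrow> 'x ^ 'b \<Rightarrow> 'y ^ 'd" where
  "tensor_op V K x = (\<chi> d. \<Sum>b\<in>UNIV. (V $ d $ b) *\<^sub>R K (x $ b))"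

definition block_proj :: "'b \<Rightarrow> 'x::zero ^ 'b \<Rightarrow> 'x ^ 'b" where
  "block_proj b x = (\<chi> c. if c = b then x $ c else 0)"

definition col_proj :: "real ^ 'b ^ 'd \<Rightarrow> 'b \<Rightarrow> 'y::real_vector ^ 'd \<Rightarrow> 'y ^ 'd" where
  "col_proj V b =
     tensor_op ((1 / (norm (column b V))\<^sup>2) *\<^sub>R (\<chi> i j. column b V $ i * column b V $ j)) (\<lambda>y. y)"

definition residual ::
    "real ^ 'b ^ 'd \<Rightarrow> ('x::real_inner \<Rightarrow> 'y::real_inner) \<Rightarrow> 'b \<Rightarrow> 'y ^ 'd \<Rightarrow> 'x ^ 'b \<Rightarrow> real" where
  "residual V K b y x = norm (col_proj V b (y - tensor_op V K x))"

text \<open>A step size rule is a function of the noise level, the data and the iteration index. Its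
  dependence on the iterates needs no separate argument, since these are determined by the data and
  the earlier step sizes. For \<open>\<delta> = 0\<close> the first branch is always taken.\<close>

primrec loping_bcd ::
    "real ^ 'b ^ 'd \<Rightarrow> ('x::real_inner \<Rightarrow> 'y::real_inner) \<Rightarrow> (nat \<Rightarrow> 'b) \<Rightarrow> real
      \<Rightarrow> (real \<Rightarrow> 'y ^ 'd \<Rightarrow> nat \<Rightarrow> real) \<Rightarrow> 'x ^ 'b \<Rightarrow> real \<Rightarrow> 'y ^ 'd \<Rightarrow> nat \<Rightarrow> 'x ^ 'b" where
  "loping_bcd V K ctrl \<tau> s x0 \<delta> yd 0 = x0"
| "loping_bcd V K ctrl \<tau> s x0 \<delta> yd (Suc k) =
     (let x = loping_bcd V K ctrl \<tau> s x0 \<delta> yd k;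
          d = (if residual V K (ctrl k) yd x \<ge> \<tau> * \<delta> then 1 else 0)
      in x - (d * s \<delta> yd k) *\<^sub>R
           block_proj (ctrl k) (adjoint (tensor_op V K) (tensor_op V K x - yd)))"

text \<open>The quantity \<open>A\<close> for block \<open>b\<close> at the iterate \<open>x\<close>. In \<open>ereal\<close>, \<open>s / \<infinity> = 0\<close>.\<close>

definition step_bound ::
    "real ^ 'b ^ 'd \<Rightarrow> ('x::real_inner \<Rightarrow> 'y::real_inner) \<Rightarrow> 'b \<Rightarrow> real \<Rightarrow> 'y ^ 'd \<Rightarrow> 'x ^ 'b \<Rightarrow> ereal" where
  "step_bound V K b \<delta> yd x =
     (let r = residual V K b yd x;
          g = (norm (tensor_op V (\<lambda>z. z)
                 (block_proj b (adjoint (tensor_op V K) (yd - tensor_op V K x)))))\<^sup>2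
      in if g = 0 then \<infinity> else ereal ((norm (column b V))\<^sup>2 * (r * (r - \<delta>)) / g))"

definition noisy_data :: "real ^ 'b ^ 'd \<Rightarrow> 'y::real_inner ^ 'd \<Rightarrow> real \<Rightarrow> 'y ^ 'd \<Rightarrow> bool" where
  "noisy_data V y \<delta> yd \<longleftrightarrow>
     0 \<le> \<delta> \<and> (\<forall>b. norm (col_proj V b (y - yd)) \<le> \<delta>) \<and> (\<delta> = 0 \<longrightarrow> yd = y)"

definition admissible_steps ::
    "real ^ 'b ^ 'd \<Rightarrow> ('x::real_inner \<Rightarrow> 'y::real_inner) \<Rightarrow> (nat \<Rightarrow> 'b) \<Rightarrow> real \<Rightarrow> 'x ^ 'b \<Rightarrow> 'y ^ 'd
      \<Rightarrow> (real \<Rightarrow> 'y ^ 'd \<Rightarrow> nat \<Rightarrow> real) \<Rightarrow> bool" where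
  "admissible_steps V K ctrl \<tau> x0 y s \<longleftrightarrow>
     (\<exists>smin smax \<theta>max. 0 < smin \<and> smin \<le> smax \<and> \<theta>max < 2 \<and>
       (\<forall>\<delta> yd k. noisy_data V y \<delta> yd \<longrightarrow>
          smin \<le> s \<delta> yd k \<and> s \<delta> yd k \<le> smax \<and>
          (let x = loping_bcd V K ctrl \<tau> s x0 \<delta> yd k;
               A = step_bound V K (ctrl k) \<delta> yd x
           in residual V K (ctrl k) yd x \<ge> \<tau> * \<delta> \<longrightarrow>
                0 < s \<delta> yd k \<and> ereal (s \<delta> yd k) < 2 * A \<and>
                ereal (s \<delta> yd k) / A \<le> ereal \<theta>max)))"

text \<open>For an admissible rule the supremum below is that of a nonempty bounded set of reals.\<close>

definition steps_continuous_at_0 ::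
    "'y::real_inner ^ 'd \<Rightarrow> (real \<Rightarrow> 'y ^ 'd \<Rightarrow> nat \<Rightarrow> real) \<Rightarrow> bool" where
  "steps_continuous_at_0 y s \<longleftrightarrow>
     (\<forall>k. ((\<lambda>\<delta>. SUP yd\<in>{yd. norm (y - yd) \<le> \<delta>}. \<bar>s \<delta> yd k - s 0 y k\<bar>) \<longlongrightarrow> 0) (at_right 0))"

text \<open>The iterate has to survive \<open>p\<close> consecutive updates, so that every block is tested once:
  \<open>x k = x (k + 1) = \<dots> = x (k + p)\<close>. Asking for equality only up to \<open>x (k + p - 1)\<close>, i.e. for \<open>p - 1\<close>
  idle updates, can leave a block untested; for \<open>p = 1\<close> that condition is void and the index always 0.\<close>

definition stopping_index :: "nat \<Rightarrow> (nat \<Rightarrow> 'a) \<Rightarrow> nat" where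
  "stopping_index p x = (LEAST k. \<forall>i\<le>p. x (k + i) = x k)"

definition min_dist_solution :: "('a::metric_space \<Rightarrow> 'c) \<Rightarrow> 'c \<Rightarrow> 'a \<Rightarrow> 'a" where
  "min_dist_solution F y x0 = (THE x. is_arg_min (\<lambda>x. dist x x0) (\<lambda>x. F x = y) x)"

end

theory Submission
  imports Defs "HOL-Library.Diagonal_Subsequence"
begin

text \<open>In the variable \<open>u = (V \<otimes> Id) x\<close> the iteration becomes a loping Landweber--Kaczmarz method for the
  equations \<open>F b u = z b\<close>, where \<open>F b u = K (\<Sum>d. V d b u d) / \<parallel>v b\<parallel>\<close> and the step sizes are
  \<open>t k = s k \<parallel>v (b k)\<parallel>\<^sup>2\<close>. The error \<open>\<parallel>u k - u\<^sup>+\<parallel>\<close> decreases by a multiple of the squared residual in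
  every active step and, as the iterates stay constant from the stopping index on, the stopped error is
  a lower bound for the errors at all indices. Along a subsequence for which all step sizes converge,
  the noisy iterates at each fixed index tend to those of an exact iteration whose step sizes satisfy
  the same bounds. So it is enough that every exact iteration has arbitrarily small errors. For this,
  the iterates at the record minima of the residual sums over cycles form a Cauchy sequence, and its limit
  is a solution whose difference to \<open>u\<^sup>+\<close> lies both in the common kernel of the \<open>F b\<close> and in its
  orthogonal complement.\<close>

section \<open>Nearest points and adjoints in Hilbert spaces\<close>

text \<open>Fixing one large \<open>M\<close> puts all later terms within \<open>e/2\<close> of
  \<open>X M\<close>. A bound in the earlier index alone is what minimizing sequences and tails of
  series provide.\<close>

lemma Cauchy_if_norm_square_le:
  fixes X :: "nat \<Rightarrow> 'a::real_normed_vector"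
  assumes le: "\<And>m n. m \<le> n \<Longrightarrow> (norm (X m - X n))\<^sup>2 \<le> g m" and g: "g \<longlonglongrightarrow> 0"
  shows "Cauchy X"
proof (rule metric_CauchyI)
  fix e :: real assume "0 < e"
  then have "0 < (e/2)\<^sup>2" by simp
  with g have "\<forall>\<^sub>F m in sequentially. g m < (e/2)\<^sup>2"
    by (rule order_tendstoD(2))
  then obtain M where M: "g M < (e/2)\<^sup>2"
    by (auto simp: eventually_sequentially)
  have "dist (X M) (X n) < e/2" if "n \<ge> M" for n
    using power2_less_imp_less[OF le_less_trans[OF le[OF that] M]] \<open>0 < e\<close> by (simp add: dist_norm)
  then have "\<forall>m\<ge>M. \<forall>n\<ge>M. dist (X m) (X n) < e"
    by (metis dist_commute dist_triangle_half_l)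
  then show "\<exists>M. \<forall>m\<ge>M. \<forall>n\<ge>M. dist (X m) (X n) < e" ..
qed

lemma parallelogram_midpoint:
  fixes a x y :: "'a::real_inner"
  shows "(norm (x - y))\<^sup>2 =
    2 * (norm (x - a))\<^sup>2 + 2 * (norm (y - a))\<^sup>2 - 4 * (norm ((1/2) *\<^sub>R (x + y) - a))\<^sup>2"
  unfolding power2_norm_eq_inner by (simp add: algebra_simps inner_commute)

text \<open>The parallelogram law makes a minimizing sequence Cauchy; its limit stays in the closed
  set.\<close>

lemma convex_closed_nearest_point:
  fixes S :: "'a::{real_inner,complete_space} set"
  assumes "convex S" "closed S" "S \<noteq> {}"
  obtains p where "p \<in> S" "\<And>x. x \<in> S \<Longrightarrow> dist p a \<le> dist x a"
proof -
  define f where "f x = (norm (x - a))\<^sup>2" for x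
  define m where "m = Inf (f ` S)"
  have m: "m \<le> f x" if "x \<in> S" for x
    unfolding m_def using that by (intro cInf_lower) (auto simp: bdd_below_def f_def intro!: exI[of _ 0])
  have "\<exists>x\<in>S. f x < m + 1 / real (Suc n)" for n
    using cInf_lessD[of "f ` S" "m + 1 / real (Suc n)"] assms(3) by (auto simp: m_def)
  then obtain q where q: "\<And>n. q n \<in> S" "\<And>n. f (q n) < m + 1 / real (Suc n)" by metis
  have "Cauchy q"
  proof (rule Cauchy_if_norm_square_le)
    fix i j :: nat assume "i \<le> j"
    then have "1 / real (Suc j) \<le> 1 / real (Suc i)" by (simp add: frac_le)
    \<comment> \<open>By convexity the midpoint competes in the infimum, so its term is at most
      \<open>-4 * m\<close> and cancels the main parts of the two upper bounds.\<close>
    moreover have "(1/2) *\<^sub>R (q i + q j) \<in> S"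
      using convexD[OF assms(1) q(1)[of i] q(1)[of j], of "1/2" "1/2"] by (simp add: scaleR_right_distrib)
    from m[OF this] have "m \<le> f ((1/2) *\<^sub>R (q i + q j))" .
    ultimately show "(norm (q i - q j))\<^sup>2 \<le> 4 * (1 / real (Suc i))"
      using q(2)[of i] q(2)[of j] parallelogram_midpoint[of "q i" "q j" a] unfolding f_def by linarith
  next
    show "(\<lambda>i. 4 * (1 / real (Suc i))) \<longlonglongrightarrow> 0"
      using tendsto_mult[OF tendsto_const[of "4::real"] LIMSEQ_inverse_real_of_nat] by (simp add: field_simps)
  qed
  then obtain p where p: "q \<longlonglongrightarrow> p"
    using Cauchy_convergent convergent_def by blast
  have pS: "p \<in> S" using closed_sequentially[OF assms(2) q(1) p] .
  have "(\<lambda>n. f (q n)) \<longlonglongrightarrow> f p" unfolding f_def by (intro tendsto_intros p)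
  moreover have "(\<lambda>n. m + 1 / real (Suc n)) \<longlonglongrightarrow> m + 0"
    using LIMSEQ_inverse_real_of_nat by (intro tendsto_intros) (simp add: field_simps)
  ultimately have "f p \<le> m + 0" by (rule LIMSEQ_le) (use q(2) less_imp_le in blast)
  then have "dist p a \<le> dist x a" if "x \<in> S" for x
    using m[OF that] unfolding f_def dist_norm by (simp add: power2_le_imp_le)
  with pS show ?thesis by (rule that)
qed

lemma nearest_point_orthogonal:
  fixes a p h :: "'a::real_inner"
  assumes "\<And>c. dist p a \<le> dist (p + c *\<^sub>R h) a"
  shows "inner (p - a) h = 0"
proof (cases "h = 0")
  case False
  \<comment> \<open>This is the minimizer of the quadratic \<open>norm (p - a + c h)^2\<close> in
    \<open>c\<close>; optimality of \<open>c = 0\<close> forces the gain to vanish.\<close>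
  define c where "c = - (inner (p - a) h / inner h h)"
  have "inner (p - a) (p - a) \<le> inner (p - a + c *\<^sub>R h) (p - a + c *\<^sub>R h)"
    using assms[of c] by (simp add: dist_norm norm_le algebra_simps)
  also have "\<dots> = inner (p - a) (p - a) + 2 * c * inner (p - a) h + c\<^sup>2 * inner h h"
    by (simp add: inner_add_left inner_add_right inner_commute power2_eq_square)
  also have "\<dots> = inner (p - a) (p - a) - (inner (p - a) h)\<^sup>2 / inner h h"
    using False by (simp add: c_def power2_eq_square field_simps)
  finally have "(inner (p - a) h)\<^sup>2 / inner h h \<le> 0" by simp
  then show ?thesis using False
    by (metis divide_le_0_iff inner_gt_zero_iff linorder_not_le zero_less_power2)
qed simp

text \<open>The representing vector is a multiple of the point of the hyperplane
  \<open>f = 1\<close> nearest to 0, which is orthogonal to the kernel of \<open>f\<close>.\<close>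

lemma Riesz_representation:
  fixes f :: "'a::{real_inner,complete_space} \<Rightarrow> real"
  assumes "bounded_linear f"
  obtains g where "\<And>x. f x = inner x g"
proof (cases "\<forall>x. f x = 0")
  case True
  then show ?thesis using that[of 0] by simp
next
  case False
  interpret f: bounded_linear f by fact
  from False obtain x1 where x1: "f x1 \<noteq> 0" by blast
  define S where "S = {x. f x = 1}"
  have "(1 / f x1) *\<^sub>R x1 \<in> S" using x1 by (simp add: S_def f.scaleR)
  then have "S \<noteq> {}" by blast
  moreover have "convex S" by (auto simp: S_def convex_def f.add f.scaleR)
  moreover have "closed S"
    unfolding S_def by (intro closed_Collect_eq continuous_intros f.continuous_on)
  ultimately obtain p where p: "p \<in> S" "\<And>x. x \<in> S \<Longrightarrow> dist p 0 \<le> dist x 0"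
    using convex_closed_nearest_point[of S 0] by blast
  have orth: "inner p h = 0" if "f h = 0" for h
    using nearest_point_orthogonal[of p 0 h] p that by (simp add: S_def f.add f.scaleR)
  have fp: "f p = 1" using p(1) by (simp add: S_def)
  then have "p \<noteq> 0" using f.zero by force
  \<comment> \<open>As \<open>f p = 1\<close>, the vector \<open>x - f x p\<close> lies in the
    kernel.\<close>
  have "f x = inner x ((1 / inner p p) *\<^sub>R p)" for x
    using orth[of "x - f x *\<^sub>R p"] fp \<open>p \<noteq> 0\<close>
    by (simp add: f.diff f.scaleR inner_diff_right inner_commute field_simps)
  then show ?thesis by (rule that)
qed

text \<open>\<open>adjoint\<close> is a choice operator, so its defining identity can be used only
  once some adjoint is known to exist.\<close>

lemma bounded_linear_adjoint_exists:
  fixes f :: "'a::{real_inner,complete_space} \<Rightarrow> 'b::real_inner"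
  assumes "bounded_linear f"
  obtains g where "\<And>x y. inner (f x) y = inner x (g y)"
proof -
  have "\<exists>g. \<forall>x. inner (f x) y = inner x g" for y
    using Riesz_representation[OF bounded_linear_compose[OF bounded_linear_inner_left assms]] by metis
  then show ?thesis using that by metis
qed

text \<open>The solution set is closed, convex and a translate of the kernel, so a nearest point
  exists and is orthogonal to the kernel. The definite description also needs uniqueness.\<close>

lemma min_dist_solution_characterization:
  fixes A :: "'a::{real_inner,complete_space} \<Rightarrow> 'c::real_normed_vector"
  assumes "bounded_linear A" "\<exists>x. A x = y"
  shows "A (min_dist_solution A y x0) = y"
    and "A h = 0 \<Longrightarrow> inner (min_dist_solution A y x0 - x0) h = 0"
proof -
  interpret A: bounded_linear A by fact
  have "convex {x. A x = y}"
    by (auto simp: convex_def A.add A.scaleR simp flip: scaleR_left_distrib)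
  moreover have "closed {x. A x = y}"
    by (intro closed_Collect_eq continuous_intros A.continuous_on)
  ultimately obtain q where q: "A q = y" "\<And>x. A x = y \<Longrightarrow> dist q x0 \<le> dist x x0"
    using convex_closed_nearest_point[of "{x. A x = y}" x0] assms(2) by auto
  have orth: "inner (q - x0) h = 0" if "A h = 0" for h
    using nearest_point_orthogonal[of q x0 h] q that by (simp add: A.add A.scaleR)
  have "min_dist_solution A y x0 = q"
    unfolding min_dist_solution_def
  proof (rule the_equality)
    show "is_arg_min (\<lambda>x. dist x x0) (\<lambda>x. A x = y) q"
      using q by (auto simp: is_arg_min_linorder)
    fix x assume "is_arg_min (\<lambda>x. dist x x0) (\<lambda>x. A x = y) x"
    then have x: "A x = y" "dist x x0 \<le> dist q x0"
      using q by (auto simp: is_arg_min_linorder)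
    \<comment> \<open>Pythagoras: two solutions differ by a kernel element, so a second minimizer
      coincides with \<open>q\<close>.\<close>
    have "(norm (x - x0))\<^sup>2 = (norm (x - q))\<^sup>2 + (norm (q - x0))\<^sup>2"
      using orth[of "x - q"] x(1) q(1)
      by (simp add: A.diff power2_norm_eq_inner algebra_simps inner_commute)
    then have "(norm (x - q))\<^sup>2 \<le> 0"
      using power_mono[OF x(2), of 2] by (simp add: dist_norm)
    then show "x = q" by simp
  qed
  then show "A (min_dist_solution A y x0) = y"
    and "A h = 0 \<Longrightarrow> inner (min_dist_solution A y x0 - x0) h = 0"
    using q orth by auto
qed

section \<open>Loping Landweber--Kaczmarz iterations\<close>

text \<open>\<open>F'\<close> is given by its adjoint identity only, so that an explicit formula can
  be supplied. \<open>ustar\<close> is any solution here; orthogonality of the initial error to the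
  common kernel is added later.\<close>

locale kaczmarz =
  fixes F :: "'i::finite \<Rightarrow> 'u::{real_inner,complete_space} \<Rightarrow> 'z::real_inner"
    and F' :: "'i \<Rightarrow> 'z \<Rightarrow> 'u"
    and z :: "'i \<Rightarrow> 'z"
    and ctrl :: "nat \<Rightarrow> 'i"
    and p :: nat
    and ustar :: 'u
  assumes bounded_linear_F: "bounded_linear (F i)"
    and adjoint_F: "inner (F i u) w = inner u (F' i w)"
    and solution: "F i ustar = z i"
    and ctrl_covers: "\<exists>j<p. ctrl (k + j) = i"
begin

lemma F_diff: "F i (u - v) = F i u - F i v"
  by (rule linear_diff[OF bounded_linear.linear[OF bounded_linear_F]])

lemma F'_diff: "F' i (v - w) = F' i v - F' i w"
  by (rule vector_eq_ldot[THEN iffD1]) (simp add: inner_diff_right flip: adjoint_F)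

lemma F'_zero: "F' i 0 = 0"
  using F'_diff[of i 0 0] by simp

text \<open>The index type is finite, so the sum of the individual bounds serves every
  \<open>F i\<close>; each \<open>F' i\<close> inherits the bound of its adjoint.\<close>

lemma norm_bounds:
  "\<exists>M>0. (\<forall>i u. norm (F i u) \<le> M * norm u) \<and> (\<forall>i w. norm (F' i w) \<le> M * norm w)"
proof -
  have "\<exists>m>0. \<forall>u. norm (F i u) \<le> norm u * m" for i
    using bounded_linear.pos_bounded[OF bounded_linear_F] by blast
  then obtain m where m: "\<And>i. m i > 0" "\<And>i u. norm (F i u) \<le> norm u * m i" by metis
  define M where "M = (\<Sum>i\<in>UNIV. m i)"
  have mM: "m i \<le> M" for i
    unfolding M_def using m(1) by (intro member_le_sum) (auto simp: less_imp_le)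
  have "M > 0" using m(1) mM less_le_trans by blast
  moreover have F: "norm (F i u) \<le> M * norm u" for i u
    using order_trans[OF m(2)[of i u] mult_left_mono[OF mM norm_ge_zero]] by (simp add: mult.commute)
  moreover have "norm (F' i w) \<le> M * norm w" for i w
  proof (cases "F' i w = 0")
    case False
    have "norm (F' i w) * norm (F' i w) = inner (F i (F' i w)) w"
      by (simp add: adjoint_F flip: power2_norm_eq_inner power2_eq_square)
    also have "\<dots> \<le> norm (F i (F' i w)) * norm w" by (rule norm_cauchy_schwarz)
    also have "\<dots> \<le> (M * norm (F' i w)) * norm w" by (intro mult_right_mono F) simp
    finally have "norm (F' i w) * norm (F' i w) \<le> (M * norm w) * norm (F' i w)" by (simp add: mult_ac)
    with False show ?thesis by simp
  qed (use \<open>M > 0\<close> in simp)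
  ultimately show ?thesis by blast
qed

lemma bounded_linear_F': "bounded_linear (F' i)"
proof -
  obtain M where "\<And>i w. norm (F' i w) \<le> M * norm w"
    using norm_bounds by blast
  moreover have "F' i (v + w) = F' i v + F' i w" for v w
    using F'_diff[of i "v + w" w] by simp
  moreover have "F' i (r *\<^sub>R w) = r *\<^sub>R F' i w" for r w
    by (rule vector_eq_ldot[THEN iffD1]) (simp flip: adjoint_F)
  ultimately show ?thesis by (intro bounded_linear_intro[where K = M]) (simp_all add: mult.commute)
qed

end

text \<open>Noisy and exact runs share this locale, the latter with \<open>\<delta> = 0\<close>. The
  step size condition is a product rather than a quotient, so it covers vanishing gradients and
  passes to limits.\<close>

locale loping_kaczmarz = kaczmarz F F' z ctrl p ustar
  for F :: "'i::finite \<Rightarrow> 'u::{real_inner,complete_space} \<Rightarrow> 'z::real_inner" and F' z ctrl p ustar +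
  fixes \<delta> \<tau> a c \<theta> :: real
    and zd :: "'i \<Rightarrow> 'z"
    and t :: "nat \<Rightarrow> real"
    and u :: "nat \<Rightarrow> 'u"
  assumes \<tau>: "1 < \<tau>"
    and \<delta>: "0 \<le> \<delta>"
    and noise: "norm (zd i - z i) \<le> \<delta>"
    and a: "0 < a" and t_ge: "a \<le> t k" and t_le: "t k \<le> c"
    and \<theta>: "0 \<le> \<theta>" "\<theta> < 2"
    and iterate: "u (Suc k) =
      (if \<tau> * \<delta> \<le> norm (F (ctrl k) (u k) - zd (ctrl k))
       then u k - t k *\<^sub>R F' (ctrl k) (F (ctrl k) (u k) - zd (ctrl k)) else u k)"
    and step_size: "\<tau> * \<delta> \<le> norm (F (ctrl k) (u k) - zd (ctrl k)) \<Longrightarrow>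
      t k * (norm (F' (ctrl k) (F (ctrl k) (u k) - zd (ctrl k))))\<^sup>2
        \<le> \<theta> * (norm (F (ctrl k) (u k) - zd (ctrl k)) * (norm (F (ctrl k) (u k) - zd (ctrl k)) - \<delta>))"
begin

section \<open>Error decrease and finite stopping\<close>

definition \<rho> where "\<rho> k = F (ctrl k) (u k) - zd (ctrl k)"

text \<open>The factors are the least step size, the slack left by the step size condition, and the
  share of the residual remaining after subtracting the noise:
  \<open>r - \<delta> \<ge> (1 - 1 / \<tau>) * r\<close> in an active step.\<close>

definition \<kappa> where "\<kappa> = a * (2 - \<theta>) * (1 - 1 / \<tau>)"

lemma \<kappa>_pos: "0 < \<kappa>"
  using a \<theta> \<tau> by (simp add: \<kappa>_def)

text \<open>Expanding the square, the cross term gains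
  \<open>2 * t k * (r * (r - \<delta>))\<close>, while the step size condition limits the quadratic
  term to \<open>\<theta>\<close> times \<open>t k * (r * (r - \<delta>))\<close>.\<close>

lemma descent:
  assumes "\<tau> * \<delta> \<le> norm (\<rho> k)"
  shows "(norm (u (Suc k) - ustar))\<^sup>2 \<le> (norm (u k - ustar))\<^sup>2 - \<kappa> * (norm (\<rho> k))\<^sup>2"
proof -
  define r where "r = norm (\<rho> k)"
  define g where "g = F' (ctrl k) (\<rho> k)"
  have r: "0 \<le> r" "\<tau> * \<delta> \<le> r" using assms by (auto simp: r_def)
  have u: "u (Suc k) - ustar = (u k - ustar) - t k *\<^sub>R g"
    using assms iterate[of k] by (simp add: \<rho>_def g_def)
  \<comment> \<open>\<open>F (u k - ustar)\<close> is the noisy residual plus the data error, whose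
    norm is at most \<open>\<delta>\<close>.\<close>
  have "inner (u k - ustar) g = inner (\<rho> k + (zd (ctrl k) - z (ctrl k))) (\<rho> k)"
    by (simp add: g_def F_diff solution \<rho>_def flip: adjoint_F)
  also have "\<dots> = r\<^sup>2 + inner (zd (ctrl k) - z (ctrl k)) (\<rho> k)"
    by (simp add: inner_add_left r_def power2_norm_eq_inner)
  also have "\<dots> \<ge> r\<^sup>2 - \<delta> * r"
    using order_trans[OF Cauchy_Schwarz_ineq2 mult_right_mono[OF noise norm_ge_zero],
        of "ctrl k" "\<rho> k"] by (simp add: r_def)
  finally have ip: "inner (u k - ustar) g \<ge> r * (r - \<delta>)" by (simp add: algebra_simps power2_eq_square)
  have tk: "0 < t k" using a t_ge[of k] by simp
  have "(norm (u (Suc k) - ustar))\<^sup>2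
      = (norm (u k - ustar))\<^sup>2 - 2 * t k * inner (u k - ustar) g + t k * (t k * (norm g)\<^sup>2)"
    unfolding u power2_norm_eq_inner by (simp add: algebra_simps inner_commute)
  also have "\<dots> \<le> (norm (u k - ustar))\<^sup>2 - 2 * t k * (r * (r - \<delta>)) + t k * (\<theta> * (r * (r - \<delta>)))"
    using ip step_size[of k] assms tk
    by (intro add_mono diff_left_mono mult_left_mono) (auto simp: g_def r_def \<rho>_def)
  also have "\<dots> = (norm (u k - ustar))\<^sup>2 - t k * (2 - \<theta>) * (r * (r - \<delta>))"
    by (simp add: algebra_simps)
  also have "\<dots> \<le> (norm (u k - ustar))\<^sup>2 - a * (2 - \<theta>) * (r * ((1 - 1 / \<tau>) * r))"
  proof -
    have "\<delta> \<le> r / \<tau>" using r \<tau> by (simp add: field_simps)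
    then have "(1 - 1 / \<tau>) * r \<le> r - \<delta>" by (simp add: algebra_simps)
    moreover have "0 \<le> (1 - 1 / \<tau>) * r" using \<tau> r by simp
    ultimately show ?thesis
      using \<theta> t_ge[of k] a r by (intro diff_left_mono mult_mono) auto
  qed
  finally show ?thesis by (simp add: \<kappa>_def r_def power2_eq_square mult_ac)
qed

lemma idle: "norm (\<rho> k) < \<tau> * \<delta> \<Longrightarrow> u (Suc k) = u k"
  using iterate[of k] by (simp add: \<rho>_def)

lemma error_Suc_le: "norm (u (Suc k) - ustar) \<le> norm (u k - ustar)"
proof (cases "\<tau> * \<delta> \<le> norm (\<rho> k)")
  case True
  have "0 \<le> \<kappa> * (norm (\<rho> k))\<^sup>2" using \<kappa>_pos by simp
  with descent[OF True] have "(norm (u (Suc k) - ustar))\<^sup>2 \<le> (norm (u k - ustar))\<^sup>2" by linarith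
  then show ?thesis by (rule power2_le_imp_le) simp
qed (simp add: idle)

lemma decseq_error: "decseq (\<lambda>k. norm (u k - ustar))"
  by (intro decseq_SucI error_Suc_le)

lemma sum_active_residuals:
  "\<kappa> * (\<Sum>k<n. if \<tau> * \<delta> \<le> norm (\<rho> k) then (norm (\<rho> k))\<^sup>2 else 0) + (norm (u n - ustar))\<^sup>2
     \<le> (norm (u 0 - ustar))\<^sup>2"
proof (induction n)
  case (Suc n)
  show ?case
    using Suc descent[of n] idle[of n] by (cases "\<tau> * \<delta> \<le> norm (\<rho> n)") (auto simp: algebra_simps)
qed simp

text \<open>All updates lie in ranges of the \<open>F' i\<close>, which are orthogonal to the common
  kernel.\<close>

lemma error_orthogonal_kernel:
  assumes "inner (u 0 - ustar) h = 0" "\<And>i. F i h = 0"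
  shows "inner (u k - ustar) h = 0"
proof (induction k)
  case (Suc k)
  have "inner (F' i w) h = 0" for i w
    using adjoint_F[of i h w] assms(2) by (simp add: inner_commute)
  with Suc show ?case by (simp add: iterate inner_diff_left)
qed (use assms in simp)

text \<open>With \<open>\<delta> > 0\<close> an active residual is nonzero, so an active step
  strictly decreases the error and must move the iterate.\<close>

lemma active_changes:
  assumes "0 < \<delta>" "u (Suc k) = u k"
  shows "norm (\<rho> k) < \<tau> * \<delta>"
proof (rule ccontr)
  assume "\<not> norm (\<rho> k) < \<tau> * \<delta>"
  then have act: "\<tau> * \<delta> \<le> norm (\<rho> k)" by simp
  then have "0 < norm (\<rho> k)" using assms(1) \<tau> by (smt (verit) mult_pos_pos)
  then have "0 < \<kappa> * (norm (\<rho> k))\<^sup>2" using \<kappa>_pos by simp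
  with descent[OF act] assms(2) show False by simp
qed

text \<open>Every equation has been tested at this same iterate within the cycle, so every later
  test repeats a test that has already failed.\<close>

lemma constant_after_idle_cycle:
  assumes "0 < \<delta>" "\<And>i. i \<le> p \<Longrightarrow> u (k + i) = u k"
  shows "u (k + n) = u k"
proof (induction n)
  case (Suc n)
  obtain j where j: "j < p" "ctrl (k + j) = ctrl (k + n)" using ctrl_covers by blast
  \<comment> \<open>Since \<open>j < p\<close>, both \<open>j\<close> and \<open>Suc j\<close> fall
    under \<open>i \<le> p\<close>; this is where \<open>p\<close> updates, not
    \<open>p - 1\<close>, must be idle.\<close>
  have "u (Suc (k + j)) = u (k + j)" using assms(2)[of j] assms(2)[of "Suc j"] j(1) by simp
  then have "norm (\<rho> (k + j)) < \<tau> * \<delta>" by (rule active_changes[OF assms(1)])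
  moreover have "\<rho> (k + j) = \<rho> (k + n)"
    using j assms(2)[of j] Suc by (simp add: \<rho>_def)
  ultimately show ?case using idle[of "k + n"] Suc by simp
qed simp

text \<open>Each active step contributes at least \<open>(\<tau> * \<delta>)^2\<close> to a bounded
  sum, so only finitely many steps are active.\<close>

lemma eventually_constant:
  assumes "0 < \<delta>"
  shows "\<exists>k. \<forall>i. u (k + i) = u k"
proof -
  define f where "f k = (if \<tau> * \<delta> \<le> norm (\<rho> k) then (norm (\<rho> k))\<^sup>2 else 0)" for k
  have "summable f"
  proof (rule summableI_nonneg_bounded)
    fix n
    have "\<kappa> * (\<Sum>k<n. f k) \<le> (norm (u 0 - ustar))\<^sup>2"
      using sum_active_residuals[of n] unfolding f_def by (smt (verit) zero_le_power2)
    then show "(\<Sum>k<n. f k) \<le> (norm (u 0 - ustar))\<^sup>2 / \<kappa>"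
      using \<kappa>_pos by (simp add: field_simps)
  qed (simp add: f_def)
  then have "f \<longlonglongrightarrow> 0" by (rule summable_LIMSEQ_zero)
  moreover have "0 < (\<tau> * \<delta>)\<^sup>2" using assms \<tau> by simp
  ultimately have "\<forall>\<^sub>F k in sequentially. f k < (\<tau> * \<delta>)\<^sup>2" by (rule order_tendstoD(2))
  then obtain N where N: "\<And>k. k \<ge> N \<Longrightarrow> f k < (\<tau> * \<delta>)\<^sup>2" by (auto simp: eventually_sequentially)
  have idleN: "u (Suc k) = u k" if "k \<ge> N" for k
  proof (rule idle, rule ccontr)
    assume "\<not> norm (\<rho> k) < \<tau> * \<delta>"
    moreover from this have "(\<tau> * \<delta>)\<^sup>2 \<le> (norm (\<rho> k))\<^sup>2"
      using \<tau> \<delta> by (intro power_mono) auto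
    ultimately show False using N[OF that] unfolding f_def by simp
  qed
  have "u (N + i) = u N" for i by (induction i) (auto simp: idleN)
  then show ?thesis by blast
qed

text \<open>By constancy the stopped error equals the error at index \<open>K + k\<close>, which
  monotonicity compares with index \<open>k\<close>, even when \<open>k < K\<close>.\<close>

lemma error_at_stopping_index_le:
  assumes "0 < \<delta>"
  shows "norm (u (stopping_index p u) - ustar) \<le> norm (u k - ustar)"
proof -
  define K where "K = stopping_index p u"
  from eventually_constant[OF assms] have "\<exists>k. \<forall>i\<le>p. u (k + i) = u k" by blast
  then have "\<forall>i\<le>p. u (K + i) = u K"
    unfolding K_def stopping_index_def by (rule LeastI_ex)
  then have "u (K + k) = u K" using constant_after_idle_cycle[OF assms, of K k] by blast
  then show ?thesis
    using decseqD[OF decseq_error, of k "K + k"] by (simp add: K_def)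
qed

end

subsection \<open>Exact data\<close>

context loping_kaczmarz
begin

text \<open>A window of length \<open>p\<close> meets every equation, so \<open>R k\<close> measures
  the violation of the whole system at \<open>u k\<close>.\<close>

definition R where "R k = (\<Sum>i<p. norm (\<rho> (k + i)))"

lemma p_pos: "0 < p"
  using ctrl_covers[of 0] by force

lemma R_nonneg: "0 \<le> R k"
  by (simp add: R_def sum_nonneg)

lemma residual_le_R: "i < p \<Longrightarrow> norm (\<rho> (k + i)) \<le> R k"
  unfolding R_def by (intro member_le_sum) auto

lemma partial_sum_residuals_le_R: "j \<le> p \<Longrightarrow> (\<Sum>i<j. norm (\<rho> (k + i))) \<le> R k"
  unfolding R_def by (intro sum_mono2) auto

text \<open>With exact data every step is active, so the residuals are square summable;
  Cauchy-Schwarz over the window transfers this to \<open>R\<close>.\<close>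

lemma summable_R_square:
  assumes "\<delta> = 0"
  shows "summable (\<lambda>k. (R k)\<^sup>2)"
proof -
  have "summable (\<lambda>k. (norm (\<rho> k))\<^sup>2)"
  proof (rule summableI_nonneg_bounded)
    fix n
    have "\<kappa> * (\<Sum>k<n. (norm (\<rho> k))\<^sup>2) \<le> (norm (u 0 - ustar))\<^sup>2"
      using order_trans[OF _ sum_active_residuals[of n]] by (simp add: assms)
    then show "(\<Sum>k<n. (norm (\<rho> k))\<^sup>2) \<le> (norm (u 0 - ustar))\<^sup>2 / \<kappa>"
      using \<kappa>_pos by (simp add: field_simps)
  qed simp
  then have sum: "summable (\<lambda>k. real p * (\<Sum>i<p. (norm (\<rho> (k + i)))\<^sup>2))"
    by (intro summable_mult summable_sum summable_ignore_initial_segment)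
  have "norm ((R k)\<^sup>2) \<le> real p * (\<Sum>i<p. (norm (\<rho> (k + i)))\<^sup>2)" for k
    unfolding R_def using sum_squared_le_sum_of_squares[of "\<lambda>i. norm (\<rho> (k + i))" "{..<p}"]
    by (simp add: mult.commute)
  then show ?thesis by (rule summable_comparison_test'[OF sum])
qed

text \<open>Equation \<open>i\<close> is tested at some \<open>k + j\<close> with
  \<open>j < p\<close>. Passing from \<open>u k\<close> to \<open>u (k + j)\<close> costs at most a
  constant times the residuals met on the way.\<close>

lemma F_error_le_R:
  assumes "\<delta> = 0"
  shows "\<exists>C\<ge>0. \<forall>i k. norm (F i (u k - ustar)) \<le> C * R k"
proof -
  obtain M where M: "M > 0" "\<And>i u. norm (F i u) \<le> M * norm u" "\<And>i w. norm (F' i w) \<le> M * norm w"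
    using norm_bounds by blast
  have zd: "zd i = z i" for i using noise[of i] assms by simp
  have c: "0 \<le> c" using a t_ge[of 0] t_le[of 0] by simp
  have step: "norm (u (Suc k) - u k) \<le> c * M * norm (\<rho> k)" for k
  proof -
    have "norm (u (Suc k) - u k) = t k * norm (F' (ctrl k) (\<rho> k))"
      using assms a t_ge[of k] by (simp add: iterate \<rho>_def)
    also have "\<dots> \<le> c * (M * norm (\<rho> k))"
      using M(3)[of "ctrl k" "\<rho> k"] t_le[of k] c by (intro mult_mono) auto
    finally show ?thesis by simp
  qed
  have shift: "norm (u (k + j) - u k) \<le> c * M * (\<Sum>i<j. norm (\<rho> (k + i)))" for k j
  proof (induction j)
    case (Suc j)
    have "norm (u (k + Suc j) - u k) \<le> norm (u (Suc (k + j)) - u (k + j)) + norm (u (k + j) - u k)"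
      using norm_triangle_ineq[of "u (Suc (k + j)) - u (k + j)" "u (k + j) - u k"] by simp
    then show ?case using Suc step[of "k + j"] by (simp add: algebra_simps)
  qed simp
  have "norm (F i (u k - ustar)) \<le> (1 + M * (c * M)) * R k" for i k
  proof -
    obtain j where j: "j < p" "ctrl (k + j) = i" using ctrl_covers by blast
    have "F i (u k - ustar) = \<rho> (k + j) - F i (u (k + j) - u k)"
      using j by (simp add: \<rho>_def zd F_diff solution)
    then have "norm (F i (u k - ustar)) \<le> norm (\<rho> (k + j)) + norm (F i (u (k + j) - u k))"
      by (metis norm_triangle_ineq4)
    also have "norm (F i (u (k + j) - u k)) \<le> M * (c * M * R k)"
    proof (rule order_trans[OF M(2)], rule mult_left_mono[OF order_trans[OF shift]])
      show "c * M * (\<Sum>i<j. norm (\<rho> (k + i))) \<le> c * M * R k"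
        using c M(1) j(1) by (intro mult_left_mono partial_sum_residuals_le_R) auto
    qed (use M(1) in simp)
    also have "norm (\<rho> (k + j)) \<le> R k" using j(1) by (rule residual_le_R)
    finally show ?thesis by (simp add: algebra_simps)
  qed
  moreover have "0 \<le> 1 + M * (c * M)" using M(1) c by simp
  ultimately show ?thesis by blast
qed

text \<open>Comparing only indices at which \<^term>\<open>R\<close> attains a new minimum lets
  the mixed terms be absorbed into a tail of the convergent series of the \<^term>\<open>(R k)\<^sup>2\<close>.\<close>

lemma inner_error_displacement_le:
  assumes "\<delta> = 0" "0 \<le> C" and C: "\<And>i k. norm (F i (u k - ustar)) \<le> C * R k"
    and min: "\<And>i. i < n \<Longrightarrow> R n \<le> R i" and "m \<le> k" "k \<le> n"
  shows "inner (u n - ustar) (u k - u m) \<le> c * C * (\<Sum>i\<in>{m..<k}. (R i)\<^sup>2)"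
  using assms(5,6)
proof (induction k rule: dec_induct)
  case (step k)
  \<comment> \<open>Moving \<open>F'\<close> across the inner product turns one displacement into a
    product of two residual-like quantities.\<close>
  have "inner (u n - ustar) (u (Suc k) - u k) = t k * - inner (F (ctrl k) (u n - ustar)) (\<rho> k)"
    using assms(1) by (simp add: iterate \<rho>_def adjoint_F)
  also have "\<dots> \<le> t k * ((C * R k) * R k)"
  proof (rule mult_left_mono)
    have "- inner (F (ctrl k) (u n - ustar)) (\<rho> k) \<le> norm (F (ctrl k) (u n - ustar)) * norm (\<rho> k)"
      using Cauchy_Schwarz_ineq2[of "F (ctrl k) (u n - ustar)" "\<rho> k"] by linarith
    also have "\<dots> \<le> (C * R k) * R k"
    proof (intro mult_mono)
      \<comment> \<open>The bound at \<open>n\<close> is \<open>C * R n\<close>, and the record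
        property replaces \<open>R n\<close> by \<open>R k\<close> because
        \<open>k < n\<close>.\<close>
      show "norm (F (ctrl k) (u n - ustar)) \<le> C * R k"
        using order_trans[OF C mult_left_mono[OF min assms(2)]] step by simp
      show "norm (\<rho> k) \<le> R k" using residual_le_R[OF p_pos, of k] by simp
    qed (use assms(2) R_nonneg in auto)
    finally show "- inner (F (ctrl k) (u n - ustar)) (\<rho> k) \<le> (C * R k) * R k" .
    show "0 \<le> t k" using a t_ge[of k] by simp
  qed
  also have "\<dots> \<le> c * ((C * R k) * R k)"
    using t_le assms(2) R_nonneg by (intro mult_right_mono) auto
  finally have "inner (u n - ustar) (u (Suc k) - u k) \<le> c * C * (R k)\<^sup>2"
    by (simp add: power2_eq_square mult_ac)
  moreover have "u (Suc k) - u m = (u k - u m) + (u (Suc k) - u k)" by simp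
  ultimately show ?case
    using step by (simp add: inner_add_right algebra_simps)
qed simp

text \<open>One small error suffices, since the stopped error of a noisy run is below its error at
  every fixed index.\<close>

lemma exists_small_error:
  assumes "\<delta> = 0" "0 < \<epsilon>"
    and orth: "\<And>h. (\<And>i. F i h = 0) \<Longrightarrow> inner (u 0 - ustar) h = 0"
  shows "\<exists>k. norm (u k - ustar) < \<epsilon>"
proof -
  obtain C where C: "C \<ge> 0" "\<And>i k. norm (F i (u k - ustar)) \<le> C * R k"
    using F_error_le_R[OF assms(1)] by blast
  have orth: "inner (u k - ustar) h = 0" if "\<And>i. F i h = 0" for k h
    using error_orthogonal_kernel[OF orth] that by blast
  show ?thesis
  proof (cases "\<exists>k. R k = 0")
    case True
    then obtain k where "R k = 0" by blast
    then have "F i (u k - ustar) = 0" for i using C(2)[of i k] by simp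
    \<comment> \<open>The error lies in the common kernel and is orthogonal to it.\<close>
    from orth[OF this, of k] have "u k = ustar" by simp
    with assms(2) show ?thesis by (intro exI[of _ k]) simp
  next
    case False
    with R_nonneg have R_pos: "0 < R k" for k by (metis order_le_less)
    note sq = summable_R_square[OF assms(1)]
    have "(\<lambda>k. sqrt ((R k)\<^sup>2)) \<longlonglongrightarrow> sqrt 0"
      by (intro tendsto_real_sqrt summable_LIMSEQ_zero sq)
    then have R0: "R \<longlonglongrightarrow> 0" by (simp add: R_nonneg)
    \<comment> \<open>A positive null sequence has infinitely many record minima: the first index
      whose value is below all of \<open>R 0, ..., R m\<close> is a record beyond
      \<open>m\<close>.\<close>
    have "infinite {n. \<forall>i<n. R n \<le> R i}"
      unfolding infinite_nat_iff_unbounded_le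
    proof
      fix m
      define b where "b = Min (R ` {..m})"
      have "b > 0" using R_pos by (simp add: b_def)
      then have "\<forall>\<^sub>F n in sequentially. R n < b" by (rule order_tendstoD(2)[OF R0])
      then have "\<exists>n. R n < b" unfolding eventually_sequentially by blast
      define n where "n = (LEAST n. R n < b)"
      have n: "R n < b" unfolding n_def using \<open>\<exists>n. R n < b\<close> by (rule LeastI_ex)
      have "m \<le> n"
      proof (rule ccontr)
        assume "\<not> m \<le> n"
        then have "b \<le> R n" unfolding b_def by (intro Min_le) auto
        with n show False by simp
      qed
      moreover have "R n \<le> R i" if "i < n" for i
        using not_less_Least[of i "\<lambda>n. R n < b"] that n unfolding n_def by simp
      ultimately show "\<exists>n\<ge>m. n \<in> {n. \<forall>i<n. R n \<le> R i}" by blast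
    qed
    from infinite_enumerate[OF this]
    obtain r :: "nat \<Rightarrow> nat" where r: "strict_mono r" "\<And>n i. i < r n \<Longrightarrow> R (r n) \<le> R i" by blast
    define P where "P n = (\<Sum>i<n. (R i)\<^sup>2)" for n
    obtain S where S: "P \<longlonglongrightarrow> S" and PS: "\<And>n. P n \<le> S"
      using summable_LIMSEQ[OF sq] sum_le_suminf[OF sq] unfolding P_def by force
    obtain L where L: "(\<lambda>k. norm (u k - ustar)) \<longlonglongrightarrow> L" "\<And>k. L \<le> norm (u k - ustar)"
      using decseq_convergent[OF decseq_error, of 0] by auto
    have L0: "0 \<le> L" using L(1) by (rule LIMSEQ_le_const) simp
    have c: "0 \<le> c" using a t_ge[of 0] t_le[of 0] by simp
    \<comment> \<open>The remaining decrease of the squared error plus twice the tail bound for the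
      mixed terms; both tend to 0.\<close>
    define g where "g m = (norm (u m - ustar))\<^sup>2 - L\<^sup>2 + 2 * (c * C * (S - P m))" for m
    have "g \<longlonglongrightarrow> L\<^sup>2 - L\<^sup>2 + 2 * (c * C * (S - S))"
      unfolding g_def by (intro tendsto_intros L S)
    then have gr: "(g \<circ> r) \<longlonglongrightarrow> 0" by (simp add: LIMSEQ_subseq_LIMSEQ r(1))
    have "(norm ((u \<circ> r) m - (u \<circ> r) n))\<^sup>2 \<le> (g \<circ> r) m" if "m \<le> n" for m n
    proof -
      have mn: "r m \<le> r n" using r(1) that by (simp add: strict_mono_less_eq)
      \<comment> \<open>The mixed term is anchored at the later index \<open>r n\<close>, whose
        record property bounds it.\<close>
      have "(norm (u (r m) - u (r n)))\<^sup>2 = (norm (u (r m) - ustar))\<^sup>2 - (norm (u (r n) - ustar))\<^sup>2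
          - 2 * inner (u (r n) - ustar) (u (r m) - u (r n))"
        unfolding power2_norm_eq_inner by (simp add: algebra_simps inner_commute)
      moreover have "inner (u (r n) - ustar) (u (r n) - u (r m)) \<le> c * C * (\<Sum>i\<in>{r m..<r n}. (R i)\<^sup>2)"
        using inner_error_displacement_le[OF assms(1) C r(2) mn] by blast
      moreover have "(\<Sum>i\<in>{r m..<r n}. (R i)\<^sup>2) = P (r n) - P (r m)"
        unfolding P_def using sum_diff_nat_ivl[of 0 "r m" "r n" "\<lambda>i. (R i)\<^sup>2"] mn
        by (simp add: atLeast0LessThan)
      moreover have "c * C * (P (r n) - P (r m)) \<le> c * C * (S - P (r m))"
        using PS c C(1) by (intro mult_left_mono) auto
      moreover have "L\<^sup>2 \<le> (norm (u (r n) - ustar))\<^sup>2"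
        using L(2) L0 by (intro power_mono)
      moreover have "inner (u (r n) - ustar) (u (r n) - u (r m)) = - inner (u (r n) - ustar) (u (r m) - u (r n))"
        by (simp add: inner_diff_right)
      ultimately show ?thesis by (simp add: g_def)
    qed
    then have "Cauchy (u \<circ> r)" by (rule Cauchy_if_norm_square_le[OF _ gr])
    then have "convergent (\<lambda>n. u (r n))" unfolding comp_def by (rule Cauchy_convergent)
    then obtain v where v: "(\<lambda>n. u (r n)) \<longlonglongrightarrow> v" unfolding convergent_def by blast
    have kernel: "F i (v - ustar) = 0" for i
    proof (rule LIMSEQ_unique)
      show "(\<lambda>n. F i (u (r n) - ustar)) \<longlonglongrightarrow> F i (v - ustar)"
        by (intro bounded_linear.tendsto[OF bounded_linear_F] tendsto_intros v)
      have "(\<lambda>n. R (r n)) \<longlonglongrightarrow> 0"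
        using LIMSEQ_subseq_LIMSEQ[OF R0 r(1)] by (simp add: comp_def)
      then have "(\<lambda>n. C * R (r n)) \<longlonglongrightarrow> 0" by (rule tendsto_mult_right_zero)
      then show "(\<lambda>n. F i (u (r n) - ustar)) \<longlonglongrightarrow> 0"
        by (rule Lim_null_comparison[rotated]) (use C(2) in auto)
    qed
    \<comment> \<open>\<open>v - ustar\<close> is in the common kernel, hence orthogonal to all
      errors and so to their limit, which is itself.\<close>
    have "inner (v - ustar) (v - ustar) = 0"
    proof (rule LIMSEQ_unique)
      show "(\<lambda>n. inner (u (r n) - ustar) (v - ustar)) \<longlonglongrightarrow> inner (v - ustar) (v - ustar)"
        by (intro tendsto_intros v)
      show "(\<lambda>n. inner (u (r n) - ustar) (v - ustar)) \<longlonglongrightarrow> 0"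
        using orth[OF kernel] by simp
    qed
    with v have "(\<lambda>n. u (r n)) \<longlonglongrightarrow> ustar" by simp
    from tendstoD[OF this assms(2)] show ?thesis
      by (auto simp: dist_norm eventually_sequentially)
  qed
qed

end

subsection \<open>Vanishing noise\<close>

context kaczmarz
begin

text \<open>The activity test always succeeds for noise level 0. The step sizes are free, so that
  limits of noisy step sizes can be inserted.\<close>

primrec exact_iterate :: "(nat \<Rightarrow> real) \<Rightarrow> 'u \<Rightarrow> nat \<Rightarrow> 'u" where
  "exact_iterate t u0 0 = u0"
| "exact_iterate t u0 (Suc k) = exact_iterate t u0 k
     - t k *\<^sub>R F' (ctrl k) (F (ctrl k) (exact_iterate t u0 k) - z (ctrl k))"

context
  fixes \<delta> :: "nat \<Rightarrow> real" and \<tau> a c \<theta> :: real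
    and zd :: "nat \<Rightarrow> 'i \<Rightarrow> 'z" and t :: "nat \<Rightarrow> nat \<Rightarrow> real" and u :: "nat \<Rightarrow> nat \<Rightarrow> 'u"
    and u0 :: 'u
  assumes loping: "\<And>j. loping_kaczmarz F F' z ctrl p ustar (\<delta> j) \<tau> a c \<theta> (zd j) (t j) (u j)"
    and \<delta>_pos: "\<And>j. 0 < \<delta> j" and \<delta>_null: "\<delta> \<longlonglongrightarrow> 0"
    and start: "\<And>j. u j 0 = u0"
    and orth: "\<And>h. (\<And>i. F i h = 0) \<Longrightarrow> inner (u0 - ustar) h = 0"
begin

text \<open>At each fixed index the noisy iterates tend to an exact iteration with the limiting step
  sizes. An index where that iteration has a small error bounds the stopped errors for large
  \<open>j\<close>.\<close>

lemma stopped_error_tendsto_0_if_steps_converge: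
  assumes t: "\<And>k. (\<lambda>j. t j k) \<longlonglongrightarrow> T k"
  shows "(\<lambda>j. norm (u j (stopping_index p (u j)) - ustar)) \<longlonglongrightarrow> 0"
proof -
  note ax = loping_kaczmarz.axioms(2)[OF loping, unfolded loping_kaczmarz_axioms_def]
  have \<tau>: "1 < \<tau>" and a: "0 < a" and \<theta>: "0 \<le> \<theta>" "\<theta> < 2"
    and t_bounds: "\<And>j k. a \<le> t j k" "\<And>j k. t j k \<le> c"
    and noise: "\<And>j i. norm (zd j i - z i) \<le> \<delta> j" using ax by blast+
  define w where "w = exact_iterate T u0"
  define \<rho> where "\<rho> j k = F (ctrl k) (u j k) - zd j (ctrl k)" for j k
  define \<rho>' where "\<rho>' k = F (ctrl k) (w k) - z (ctrl k)" for k
  have iterate: "u j (Suc k) = (if \<tau> * \<delta> j \<le> norm (\<rho> j k) then u j k - t j k *\<^sub>R F' (ctrl k) (\<rho> j k) else u j k)"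
    for j k using ax unfolding \<rho>_def by blast
  have step_size: "t j k * (norm (F' (ctrl k) (\<rho> j k)))\<^sup>2 \<le> \<theta> * (norm (\<rho> j k) * (norm (\<rho> j k) - \<delta> j))"
    if "\<tau> * \<delta> j \<le> norm (\<rho> j k)" for j k using ax that unfolding \<rho>_def by blast
  have zd: "(\<lambda>j. zd j i) \<longlonglongrightarrow> z i" for i
    by (rule Lim_transform2[OF tendsto_const], rule Lim_null_comparison[OF _ \<delta>_null]) 
      (use noise in \<open>simp add: norm_minus_commute\<close>)
  have \<tau>\<delta>: "(\<lambda>j. \<tau> * \<delta> j) \<longlonglongrightarrow> 0" using \<delta>_null by (rule tendsto_mult_right_zero)
  have \<rho>_lim: "(\<lambda>j. \<rho> j k) \<longlonglongrightarrow> \<rho>' k" if "(\<lambda>j. u j k) \<longlonglongrightarrow> w k" for k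
    unfolding \<rho>_def \<rho>'_def by (intro tendsto_intros bounded_linear.tendsto[OF bounded_linear_F] zd that)
  have u_lim: "(\<lambda>j. u j k) \<longlonglongrightarrow> w k" for k
  proof (induction k)
    case (Suc k)
    \<comment> \<open>The activity test is discontinuous, but an idle step is a step with its
      residual replaced by 0. The discarded part \<open>q j\<close> is below
      \<open>\<tau> * \<delta> j\<close>, so the limit does not see it.\<close>
    define q where "q j = (if \<tau> * \<delta> j \<le> norm (\<rho> j k) then 0 else \<rho> j k)" for j
    have "q \<longlonglongrightarrow> 0"
    proof (rule Lim_null_comparison[OF _ \<tau>\<delta>])
      show "\<forall>\<^sub>F j in sequentially. norm (q j) \<le> \<tau> * \<delta> j"
        using \<tau> \<delta>_pos by (auto simp: q_def less_imp_le)
    qed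
    then have "(\<lambda>j. u j k - t j k *\<^sub>R F' (ctrl k) (\<rho> j k - q j))
        \<longlonglongrightarrow> w k - T k *\<^sub>R F' (ctrl k) (\<rho>' k - 0)"
      by (intro tendsto_intros Suc t \<rho>_lim bounded_linear.tendsto[OF bounded_linear_F'])
    moreover have "u j (Suc k) = u j k - t j k *\<^sub>R F' (ctrl k) (\<rho> j k - q j)" for j
      by (simp add: iterate q_def F'_zero)
    ultimately show ?case by (simp add: w_def \<rho>'_def)
  qed (simp add: w_def start)
  obtain M where M: "M > 0" "\<And>i w. norm (F' i w) \<le> M * norm w"
    using norm_bounds by blast
  have T_bounds: "a \<le> T k" "T k \<le> c" for k
    using LIMSEQ_le_const[OF t] LIMSEQ_le_const2[OF t] t_bounds by blast+
  \<comment> \<open>The step size condition is known for active steps only. The extra term covers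
    idle ones, whose residuals are below \<open>\<tau> * \<delta> j\<close>, and becomes the
    displayed 0 in the limit.\<close>
  have "T k * (norm (F' (ctrl k) (\<rho>' k)))\<^sup>2 \<le> \<theta> * (norm (\<rho>' k))\<^sup>2 + c * (M * 0)\<^sup>2" for k
  proof (rule LIMSEQ_le)
    show "(\<lambda>j. t j k * (norm (F' (ctrl k) (\<rho> j k)))\<^sup>2) \<longlonglongrightarrow> T k * (norm (F' (ctrl k) (\<rho>' k)))\<^sup>2"
      by (intro tendsto_intros t bounded_linear.tendsto[OF bounded_linear_F'] \<rho>_lim u_lim)
    show "(\<lambda>j. \<theta> * (norm (\<rho> j k))\<^sup>2 + c * (M * (\<tau> * \<delta> j))\<^sup>2)
        \<longlonglongrightarrow> \<theta> * (norm (\<rho>' k))\<^sup>2 + c * (M * 0)\<^sup>2"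
      by (intro tendsto_intros \<rho>_lim u_lim \<tau>\<delta>)
    have "t j k * (norm (F' (ctrl k) (\<rho> j k)))\<^sup>2
        \<le> \<theta> * (norm (\<rho> j k))\<^sup>2 + c * (M * (\<tau> * \<delta> j))\<^sup>2" for j
    proof (cases "\<tau> * \<delta> j \<le> norm (\<rho> j k)")
      case True
      have "norm (\<rho> j k) * (norm (\<rho> j k) - \<delta> j) \<le> (norm (\<rho> j k))\<^sup>2"
        using \<delta>_pos[of j] by (simp add: power2_eq_square mult_left_mono)
      from mult_left_mono[OF this \<theta>(1)] step_size[OF True]
      have "t j k * (norm (F' (ctrl k) (\<rho> j k)))\<^sup>2 \<le> \<theta> * (norm (\<rho> j k))\<^sup>2" by linarith
      moreover have "0 \<le> c * (M * (\<tau> * \<delta> j))\<^sup>2"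
        using a T_bounds[of k] by (intro mult_nonneg_nonneg) auto
      ultimately show ?thesis by linarith
    next
      case False
      then have "M * norm (\<rho> j k) \<le> M * (\<tau> * \<delta> j)" using M(1) by (intro mult_left_mono) auto
      then have "norm (F' (ctrl k) (\<rho> j k)) \<le> M * (\<tau> * \<delta> j)" using M(2) order_trans by blast
      then have "t j k * (norm (F' (ctrl k) (\<rho> j k)))\<^sup>2 \<le> c * (M * (\<tau> * \<delta> j))\<^sup>2"
        using t_bounds[where j = j and k = k] a by (intro mult_mono power_mono) auto
      moreover have "0 \<le> \<theta> * (norm (\<rho> j k))\<^sup>2" using \<theta>(1) by simp
      ultimately show ?thesis by linarith
    qed
    then show "\<exists>N. \<forall>j\<ge>N. t j k * (norm (F' (ctrl k) (\<rho> j k)))\<^sup>2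
        \<le> \<theta> * (norm (\<rho> j k))\<^sup>2 + c * (M * (\<tau> * \<delta> j))\<^sup>2" by blast
  qed
  then interpret exact: loping_kaczmarz F F' z ctrl p ustar 0 \<tau> a c \<theta> z T w
    using \<tau> a T_bounds \<theta> by unfold_locales (auto simp: \<rho>'_def w_def power2_eq_square)
  show ?thesis
  proof (rule LIMSEQ_I)
    fix \<epsilon> :: real assume "0 < \<epsilon>"
    moreover have "inner (w 0 - ustar) h = 0" if "\<And>i. F i h = 0" for h
      using orth[OF that] by (simp add: w_def)
    ultimately obtain k where "norm (w k - ustar) < \<epsilon>"
      using exact.exists_small_error by blast
    moreover have "(\<lambda>j. norm (u j k - ustar)) \<longlonglongrightarrow> norm (w k - ustar)"
      by (intro tendsto_intros u_lim)
    ultimately have "\<forall>\<^sub>F j in sequentially. norm (u j k - ustar) < \<epsilon>"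
      by (rule order_tendstoD(2)[rotated])
    then have "\<forall>\<^sub>F j in sequentially. norm (u j (stopping_index p (u j)) - ustar) < \<epsilon>"
      by eventually_elim
        (rule le_less_trans[OF loping_kaczmarz.error_at_stopping_index_le[OF loping \<delta>_pos]])
    then show "\<exists>N. \<forall>j\<ge>N. norm (norm (u j (stopping_index p (u j)) - ustar) - 0) < \<epsilon>"
      by (simp add: eventually_sequentially)
  qed
qed

end

text \<open>Otherwise some subsequence keeps its distance from \<open>ustar\<close>. The step sizes
  lie in the compact interval \<open>{a..c}\<close>, so a diagonal subsequence makes them converge
  for all \<open>k\<close> at once, contradicting the previous lemma.\<close>

lemma stopped_iterates_converge:
  fixes \<delta> :: "nat \<Rightarrow> real" and u :: "nat \<Rightarrow> nat \<Rightarrow> 'u"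
  assumes loping: "\<And>j. loping_kaczmarz F F' z ctrl p ustar (\<delta> j) \<tau> a c \<theta> (zd j) (t j) (u j)"
    and \<delta>_pos: "\<And>j. 0 < \<delta> j" and \<delta>_null: "\<delta> \<longlonglongrightarrow> 0"
    and start: "\<And>j. u j 0 = u0"
    and orth: "\<And>h. (\<And>i. F i h = 0) \<Longrightarrow> inner (u0 - ustar) h = 0"
  shows "(\<lambda>j. u j (stopping_index p (u j))) \<longlonglongrightarrow> ustar"
proof (rule ccontr)
  define E where "E j = norm (u j (stopping_index p (u j)) - ustar)" for j
  assume "\<not> ?thesis"
  then obtain \<epsilon> where \<epsilon>: "0 < \<epsilon>" "infinite {j. \<epsilon> \<le> E j}"
    unfolding LIMSEQ_iff infinite_nat_iff_unbounded_le E_def by (auto simp: not_less)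
  from infinite_enumerate[OF \<epsilon>(2)]
  obtain r :: "nat \<Rightarrow> nat" where r: "strict_mono r" "\<And>n. \<epsilon> \<le> E (r n)" by blast
  have t_bounds: "t j k \<in> {a..c}" for j k
    using loping_kaczmarz.t_ge[OF loping] loping_kaczmarz.t_le[OF loping] by simp
  interpret subseqs "\<lambda>k s. convergent (\<lambda>n. t (r (s n)) k)"
  proof
    fix k and s :: "nat \<Rightarrow> nat"
    have "bounded (range (\<lambda>n. t (r (s n)) k))"
      by (rule bounded_subset[OF bounded_closed_interval[of a c]]) (use t_bounds in blast)
    from bounded_imp_convergent_subsequence[OF this]
    show "\<exists>r'. strict_mono r' \<and> convergent (\<lambda>n. t (r ((s \<circ> r') n)) k)"
      unfolding convergent_def comp_def by blast
  qed
  have "convergent (\<lambda>n. t (r (diagseq n)) k)" for k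
  proof -
    \<comment> \<open>Only the tail of \<open>diagseq\<close> after \<open>k\<close> is a
      subsequence of the selection made for \<open>k\<close>.\<close>
    have "convergent (\<lambda>n. t (r ((diagseq \<circ> (+) (Suc k)) n)) k)"
    proof (rule diagseq_holds)
      fix r' s n
      assume "strict_mono (r' :: nat \<Rightarrow> nat)" "convergent (\<lambda>j. t (r (s j)) n)"
      then show "convergent (\<lambda>j. t (r ((s \<circ> r') j)) n)"
        using convergent_subseq_convergent[of "\<lambda>j. t (r (s j)) n" r'] by (simp add: comp_def)
    qed
    then have "convergent (\<lambda>n. t (r (diagseq (n + Suc k))) k)" by (simp add: add.commute)
    then show ?thesis by (rule convergent_ignore_initial_segment[THEN iffD1])
  qed
  then have T: "(\<lambda>n. t (r (diagseq n)) k) \<longlonglongrightarrow> lim (\<lambda>n. t (r (diagseq n)) k)" for k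
    by (simp add: convergent_LIMSEQ_iff)
  have "strict_mono (r \<circ> diagseq)" using r(1) subseq_diagseq by (rule strict_mono_o)
  then have "(\<lambda>n. \<delta> (r (diagseq n))) \<longlonglongrightarrow> 0"
    using LIMSEQ_subseq_LIMSEQ[OF \<delta>_null] by (simp add: comp_def)
  then have "(\<lambda>n. E (r (diagseq n))) \<longlonglongrightarrow> 0"
    unfolding E_def
    by (rule stopped_error_tendsto_0_if_steps_converge[where u = "\<lambda>n. u (r (diagseq n))"
          and t = "\<lambda>n. t (r (diagseq n))", OF loping \<delta>_pos _ start orth T])
  then have "\<epsilon> \<le> 0" by (rule LIMSEQ_le_const) (use r(2) in auto)
  with \<epsilon>(1) show False by simp
qed

end

section \<open>Tensor product operators\<close>

lemma bounded_linear_vec_lambda: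
  fixes f :: "'n::finite \<Rightarrow> 'a::real_normed_vector \<Rightarrow> 'c::real_normed_vector"
  assumes "\<And>i. bounded_linear (f i)"
  shows "bounded_linear (\<lambda>x. \<chi> i. f i x)"
proof -
  obtain m where m: "\<And>i x. norm (f i x) \<le> norm x * m i"
    using bounded_linear.bounded[OF assms] by metis
  show ?thesis
  proof (rule bounded_linear_intro[where K = "\<Sum>i\<in>UNIV. m i"])
    fix x
    have "norm (\<chi> i. f i x) \<le> (\<Sum>i\<in>UNIV. norm (f i x))"
      unfolding norm_vec_def by (rule order_trans[OF L2_set_le_sum]) auto
    also have "\<dots> \<le> norm x * (\<Sum>i\<in>UNIV. m i)"
      unfolding sum_distrib_left by (intro sum_mono m)
    finally show "norm (\<chi> i. f i x) \<le> norm x * (\<Sum>i\<in>UNIV. m i)" .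
  qed (simp_all add: vec_eq_iff linear_add[OF bounded_linear.linear[OF assms]]
        linear_scale[OF bounded_linear.linear[OF assms]])
qed

lemma norm_vec_square: "(norm x)\<^sup>2 = (\<Sum>i\<in>UNIV. (norm (x $ i))\<^sup>2)"
  for x :: "'a::real_inner ^ 'n"
  by (simp add: power2_norm_eq_inner inner_vec_def)

lemma bounded_linear_tensor_op:
  assumes "bounded_linear K"
  shows "bounded_linear (tensor_op V K)"
  unfolding tensor_op_def
  by (intro bounded_linear_vec_lambda bounded_linear_sum bounded_linear_const_scaleR
      bounded_linear_compose[OF assms bounded_linear_vec_nth])

text \<open>Allows convergence of the transformed iterates to be carried back to the original
  ones.\<close>

lemma tensor_op_left_inverse:
  assumes "W ** V = mat 1"
  shows "tensor_op W (\<lambda>x. x) (tensor_op V (\<lambda>x. x) x) = x"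
proof -
  have "(\<Sum>d\<in>UNIV. W $ b $ d *\<^sub>R (\<Sum>c\<in>UNIV. V $ d $ c *\<^sub>R x $ c))
      = (\<Sum>c\<in>UNIV. (W ** V) $ b $ c *\<^sub>R x $ c)" for b
    unfolding matrix_matrix_mult_def scaleR_sum_right
    by (subst sum.swap) (simp add: scaleR_sum_left)
  also have "\<dots> b = x $ b" for b
  proof -
    have "(\<Sum>c\<in>UNIV. (W ** V) $ b $ c *\<^sub>R x $ c) = (\<Sum>c\<in>UNIV. if c = b then x $ c else 0)"
      by (intro sum.cong) (auto simp: assms mat_def)
    then show ?thesis by simp
  qed
  finally show ?thesis by (simp add: tensor_op_def vec_eq_iff)
qed

text \<open>The coordinate along the normalized column. Followed by its adjoint
  \<open>col_embed\<close>, an isometry for a nonzero column, it gives \<open>col_proj\<close>;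
  projected residuals thus become residuals in a single copy of the space.\<close>

definition col_coeff :: "real ^ 'b ^ 'd \<Rightarrow> 'b \<Rightarrow> 'z::real_vector ^ 'd \<Rightarrow> 'z" where
  "col_coeff V b w = (1 / norm (column b V)) *\<^sub>R (\<Sum>d\<in>UNIV. V $ d $ b *\<^sub>R w $ d)"

definition col_embed :: "real ^ 'b ^ 'd \<Rightarrow> 'b \<Rightarrow> 'z::real_vector \<Rightarrow> 'z ^ 'd" where
  "col_embed V b w = (\<chi> d. (V $ d $ b / norm (column b V)) *\<^sub>R w)"

lemma bounded_linear_col_coeff: "bounded_linear (col_coeff V b)"
  unfolding col_coeff_def
  by (intro bounded_linear_const_scaleR bounded_linear_sum bounded_linear_vec_nth)

lemmas col_coeff_diff = linear_diff[OF bounded_linear.linear[OF bounded_linear_col_coeff]]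

lemma inner_col_coeff: "inner (col_coeff V b u) w = inner u (col_embed V b w)"
  by (simp add: col_coeff_def col_embed_def inner_vec_def inner_sum_left sum_divide_distrib)

lemma col_proj_eq: "col_proj V b w = col_embed V b (col_coeff V b w)"
  by (simp add: col_proj_def tensor_op_def col_embed_def col_coeff_def column_def vec_eq_iff
      scaleR_sum_right power2_eq_square)

lemma norm_col_embed:
  fixes w :: "'z::real_inner"
  assumes "column b V \<noteq> 0"
  shows "norm (col_embed V b w) = norm w"
proof -
  have "(norm (col_embed V b w))\<^sup>2 = (\<Sum>d\<in>UNIV. (V $ d $ b)\<^sup>2) / (norm (column b V))\<^sup>2 * (norm w)\<^sup>2"
    unfolding norm_vec_square[of "col_embed V b w"]
    by (simp add: col_embed_def power_mult_distrib power_divide sum_distrib_right sum_divide_distrib)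
  also have "(\<Sum>d\<in>UNIV. (V $ d $ b)\<^sup>2) = (norm (column b V))\<^sup>2"
    unfolding norm_vec_square[of "column b V"] by (simp add: column_def)
  finally show ?thesis using assms by simp
qed

lemma norm_col_proj:
  fixes w :: "'z::real_inner ^ 'd"
  assumes "column b V \<noteq> 0"
  shows "norm (col_proj V b w) = norm (col_coeff V b w)"
  by (simp add: col_proj_eq norm_col_embed assms)

lemma col_coeff_tensor_op:
  assumes "linear K"
  shows "col_coeff V b (tensor_op V K x) = K (col_coeff V b (tensor_op V (\<lambda>x. x) x))"
  by (simp add: col_coeff_def tensor_op_def linear_scale[OF assms] linear_sum[OF assms])

lemma tensor_op_block_proj:
  "tensor_op V (\<lambda>x. x) (block_proj b (x :: 'x::real_vector ^ 'b)) = norm (column b V) *\<^sub>R col_embed V b (x $ b)"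
proof -
  have "(\<Sum>c\<in>UNIV. V $ d $ c *\<^sub>R (if c = b then x $ c else 0)) = V $ d $ b *\<^sub>R x $ b" for d
    by (subst sum.mono_neutral_right[of _ "{b}"]) auto
  \<comment> \<open>For a zero column the quotient is 0 and so is the entry.\<close>
  moreover have "norm (column b V) * (V $ d $ b / norm (column b V)) = V $ d $ b" for d
    by (cases "column b V = 0") (auto simp: vec_eq_iff column_def)
  ultimately show ?thesis
    by (simp add: vec_eq_iff tensor_op_def block_proj_def col_embed_def)
qed

text \<open>The factor \<open>norm (column b V)\<close> undoes the normalization inside
  \<open>col_coeff\<close>.\<close>

lemma adjoint_tensor_op:
  fixes K :: "'x::real_inner \<Rightarrow> 'y::real_inner" and V :: "real ^ 'b ^ 'd"
  assumes K': "\<And>x y. inner (K x) y = inner x (K' y)"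
    and "\<And>b. column b V \<noteq> 0"
  shows "adjoint (tensor_op V K) w = (\<chi> b. norm (column b V) *\<^sub>R K' (col_coeff V b w))"
proof -
  have "inner (tensor_op V K x) y = inner x (\<chi> b. norm (column b V) *\<^sub>R K' (col_coeff V b y))" for x y
  proof -
    have "inner (tensor_op V K x) y = (\<Sum>b\<in>UNIV. \<Sum>d\<in>UNIV. V $ d $ b * inner (K (x $ b)) (y $ d))"
      by (subst sum.swap) (simp add: inner_vec_def tensor_op_def inner_sum_left)
    also have "\<dots> = (\<Sum>b\<in>UNIV. inner (x $ b) (norm (column b V) *\<^sub>R K' (col_coeff V b y)))"
      using assms(2) by (simp add: col_coeff_def inner_sum_right flip: K')
    finally show ?thesis by (simp add: inner_vec_def)
  qed
  then have "adjoint (tensor_op V K) = (\<lambda>y. \<chi> b. norm (column b V) *\<^sub>R K' (col_coeff V b y))"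
    by (intro adjoint_unique) blast
  then show ?thesis by simp
qed

text \<open>Turns the extended-real quotient into the product form of the locale. Admissibility
  bounds \<open>\<theta>\<close> only from above, hence the maximum with 0.\<close>

lemma step_size_bound_cases:
  fixes s q g \<theta> :: real
  defines "A \<equiv> (if g = 0 then \<infinity> else ereal (q / g))"
  assumes "0 < s" "0 \<le> g" "0 \<le> q" "ereal s < 2 * A" "ereal s / A \<le> ereal \<theta>"
  shows "s * g \<le> max \<theta> 0 * q"
proof (cases "g = 0")
  case False
  then have g: "0 < g" using assms(3) by simp
  have A: "A = ereal (q / g)" using False by (simp add: A_def)
  \<comment> \<open>With \<open>0 < s\<close> this makes \<open>q / g\<close> positive, so the
    quotient below is an ordinary real one.\<close>
  have "s < 2 * (q / g)"
    using assms(5) unfolding A by (metis ereal_less_eq(3) linorder_not_le numeral_eq_ereal times_ereal.simps(1))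
  then have "0 < q / g" using assms(2) by simp
  then have "s / (q / g) \<le> \<theta>"
    using assms(6) unfolding A by (metis ereal_divide ereal_less_eq(3) less_irrefl)
  then have "s \<le> \<theta> * (q / g)" using pos_divide_le_eq[OF \<open>0 < q / g\<close>, of s \<theta>] by blast
  then have "s * g \<le> \<theta> * q" using g by (simp add: field_simps)
  also have "\<dots> \<le> max \<theta> 0 * q" using assms(4) by (intro mult_right_mono) auto
  finally show ?thesis .
qed (use assms in simp)

section \<open>Block coordinate descent as a loping Kaczmarz iteration\<close>

theorem theorem3p4:
  fixes K :: "'x::{real_inner, complete_space} \<Rightarrow> 'y::{real_inner, complete_space}"
    and V :: "real ^ 'b ^ 'd"
    and ctrl :: "nat \<Rightarrow> 'b"
    and p :: nat
    and y :: "'y ^ 'd"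
    and x0 :: "'x ^ 'b"
    and \<tau> :: real
    and s :: "real \<Rightarrow> 'y ^ 'd \<Rightarrow> nat \<Rightarrow> real"
    and \<delta> :: "nat \<Rightarrow> real"
    and yn :: "nat \<Rightarrow> 'y ^ 'd"
  assumes "bounded_linear K"
    and "rank V = CARD('b)"
    and "p \<ge> 1"
    and "\<And>k. ctrl ` {k..k + p - 1} = UNIV"
    and "\<exists>x. tensor_op V K x = y"
    and "\<tau> > 1"
    and "admissible_steps V K ctrl \<tau> x0 y s"
    and "steps_continuous_at_0 y s"
    and "\<And>j. \<delta> j > 0"
    and "\<delta> \<longlonglongrightarrow> 0"
    and "\<And>j b. norm (col_proj V b (yn j - y)) \<le> \<delta> j"
  shows "(\<lambda>j. let x = loping_bcd V K ctrl \<tau> s x0 (\<delta> j) (yn j) in x (stopping_index p x))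
           \<longlonglongrightarrow> min_dist_solution (tensor_op V K) y x0"
proof -
  define VX where "VX = tensor_op V (\<lambda>x::'x. x)"
  define n where "n b = norm (column b V)" for b
  define xplus where "xplus = min_dist_solution (tensor_op V K) y x0"
  define x where "x j = loping_bcd V K ctrl \<tau> s x0 (\<delta> j) (yn j)" for j
  have linK: "linear K" using assms(1) by (rule bounded_linear.linear)
  \<comment> \<open>Full column rank gives a left inverse, which excludes zero columns and later
    recovers \<open>x\<close> from \<open>VX x\<close>.\<close>
  obtain W where "W ** V = mat 1"
    using assms(2) full_rank_injective[of V] matrix_left_invertible_injective[of V] by auto
  have column: "column b V \<noteq> 0" for b
  proof
    assume "column b V = 0"
    then have "(W ** V) $ b $ b = 0" by (simp add: matrix_matrix_mult_def column_def vec_eq_iff)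
    then show False by (simp add: \<open>W ** V = mat 1\<close> mat_def)
  qed
  then have n_pos: "0 < n b" for b by (simp add: n_def)
  have W: "tensor_op W (\<lambda>x. x) (VX v) = v" for v :: "'x ^ 'b"
    unfolding VX_def using \<open>W ** V = mat 1\<close> by (rule tensor_op_left_inverse)
  have VX_diff: "VX (v - w) = VX v - VX w" for v w
    unfolding VX_def
    by (rule linear_diff[OF bounded_linear.linear[OF bounded_linear_tensor_op[OF bounded_linear_ident]]])
  have VX_scale: "VX (r *\<^sub>R v) = r *\<^sub>R VX v" for r v
    unfolding VX_def
    by (rule linear_scale[OF bounded_linear.linear[OF bounded_linear_tensor_op[OF bounded_linear_ident]]])
  obtain K' where K': "\<And>v w. inner (K v) w = inner v (K' w)"
    using bounded_linear_adjoint_exists[OF assms(1)] by metis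
  define F where "F b v = K (col_coeff V b v)" for b v
  define F' where "F' b w = col_embed V b (K' w)" for b w
  have F_VX: "F b (VX v) = col_coeff V b (tensor_op V K v)" for b v
    unfolding F_def VX_def by (rule col_coeff_tensor_op[OF linK, symmetric])
  \<comment> \<open>One factor \<open>n b\<close> comes from the adjoint, the other from
    \<open>VX\<close> acting on a single block; their product enters the step size
    \<open>t\<close>.\<close>
  have gradient: "VX (block_proj b (adjoint (tensor_op V K) w)) = (n b)\<^sup>2 *\<^sub>R F' b (col_coeff V b w)" for b w
    unfolding VX_def tensor_op_block_proj adjoint_tensor_op[OF K' column]
    by (simp add: F'_def n_def power2_eq_square col_embed_def vec_eq_iff)
  have solution: "tensor_op V K xplus = y"
    and minimal: "\<And>h. tensor_op V K h = 0 \<Longrightarrow> inner (xplus - x0) h = 0"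
    unfolding xplus_def
    using min_dist_solution_characterization[OF bounded_linear_tensor_op[OF assms(1)] assms(5)] by blast+
  interpret kaczmarz F F' "\<lambda>b. col_coeff V b y" ctrl p "VX xplus"
  proof (rule kaczmarz.intro)
    show "bounded_linear (F b)" for b
      unfolding F_def by (rule bounded_linear_compose[OF assms(1) bounded_linear_col_coeff])
    show "inner (F b v) w = inner v (F' b w)" for b v w
      by (simp add: F_def F'_def K' inner_col_coeff)
    show "F b (VX xplus) = col_coeff V b y" for b by (simp add: F_VX solution)
    show "\<exists>j<p. ctrl (k + j) = b" for k b
    proof -
      obtain i where "i \<in> {k..k + p - 1}" "ctrl i = b" using assms(4)[of k] by (metis UNIV_I imageE)
      then show ?thesis using assms(3) by (intro exI[of _ "i - k"]) auto
    qed
  qed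
  have orth: "inner (VX x0 - VX xplus) u = 0" if "\<And>b. F b u = 0" for u
  proof -
    \<comment> \<open>\<open>h\<close> is the adjoint of \<open>VX\<close> applied to
      \<open>u\<close>. It lies in the kernel of the forward operator, where minimality of
      \<open>xplus\<close> applies.\<close>
    define h where "h = (\<chi> b. n b *\<^sub>R col_coeff V b u)"
    have "K (h $ b) = 0" for b using that[of b] by (simp add: h_def F_def linear_scale[OF linK])
    then have "tensor_op V K h = 0" by (simp add: tensor_op_def vec_eq_iff)
    then have "inner (x0 - xplus) h = 0" using minimal[of h] by (simp add: inner_diff_left)
    moreover have "inner (VX v) u = inner v h" for v
    proof -
      have "inner (VX v) u = (\<Sum>b\<in>UNIV. \<Sum>d\<in>UNIV. V $ d $ b * inner (v $ b) (u $ d))"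
        by (subst sum.swap) (simp add: inner_vec_def VX_def tensor_op_def inner_sum_left)
      also have "\<dots> = inner v h"
        using n_pos by (simp add: h_def inner_vec_def col_coeff_def inner_sum_right n_def[symmetric] less_imp_neq[symmetric])
      finally show ?thesis .
    qed
    ultimately show ?thesis by (simp flip: VX_diff)
  qed
  obtain smin smax \<theta> where sm: "0 < smin" "smin \<le> smax" "\<theta> < 2"
    and adm: "\<And>\<delta> yd k. noisy_data V y \<delta> yd \<Longrightarrow> smin \<le> s \<delta> yd k \<and> s \<delta> yd k \<le> smax \<and>
          (let x = loping_bcd V K ctrl \<tau> s x0 \<delta> yd k;
               A = step_bound V K (ctrl k) \<delta> yd x
           in residual V K (ctrl k) yd x \<ge> \<tau> * \<delta> \<longrightarrow>
                0 < s \<delta> yd k \<and> ereal (s \<delta> yd k) < 2 * A \<and>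
                ereal (s \<delta> yd k) / A \<le> ereal \<theta>)"
    using assms(7) unfolding admissible_steps_def by blast
  \<comment> \<open>The finitely many squared column norms have a positive minimum and a maximum,
    which give bounds for \<open>t\<close> uniform in \<open>j\<close> and \<open>k\<close>.\<close>
  define a where "a = smin * Min (range (\<lambda>b. (n b)\<^sup>2))"
  define c where "c = smax * Max (range (\<lambda>b. (n b)\<^sup>2))"
  define t where "t j k = s (\<delta> j) (yn j) k * (n (ctrl k))\<^sup>2" for j k
  define zd where "zd j b = col_coeff V b (yn j)" for j b
  have noisy: "noisy_data V y (\<delta> j) (yn j)" for j
    using assms(9)[of j] assms(11)[of _ j]
    by (simp add: noisy_data_def norm_col_proj[OF column] col_coeff_diff norm_minus_commute less_imp_le)
  have s_bounds: "smin \<le> s (\<delta> j) (yn j) k" "s (\<delta> j) (yn j) k \<le> smax" for j k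
    using adm[OF noisy] by blast+
  have residual: "residual V K b (yn j) v = norm (F b (VX v) - zd j b)" for b j v
    by (simp add: residual_def norm_col_proj[OF column] F_VX zd_def col_coeff_diff norm_minus_commute)
  have loping: "loping_kaczmarz F F' (\<lambda>b. col_coeff V b y) ctrl p (VX xplus) (\<delta> j) \<tau> a c (max \<theta> 0)
      (zd j) (t j) (\<lambda>k. VX (x j k))" for j
  proof
    show "1 < \<tau>" "0 \<le> \<delta> j" "0 \<le> max \<theta> 0" "max \<theta> 0 < 2"
      using assms(6) assms(9)[of j] sm by auto
    show "norm (zd j b - col_coeff V b y) \<le> \<delta> j" for b
      using assms(11)[of b j] by (simp add: zd_def norm_col_proj[OF column] col_coeff_diff)
    have "Min (range (\<lambda>b. (n b)\<^sup>2)) > 0" using n_pos by (simp add: zero_less_power2 less_imp_neq[symmetric])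
    then show "0 < a" using sm by (simp add: a_def)
    show "a \<le> t j k" for k
      unfolding a_def t_def using sm s_bounds[of j k] \<open>Min _ > 0\<close> by (intro mult_mono Min_le) auto
    show "t j k \<le> c" for k
      unfolding c_def t_def using sm s_bounds[of j k] by (intro mult_mono Max_ge) auto
    fix k
    define \<rho> where "\<rho> = F (ctrl k) (VX (x j k)) - zd j (ctrl k)"
    define r where "r = norm \<rho>"
    have \<rho>: "\<rho> = col_coeff V (ctrl k) (tensor_op V K (x j k) - yn j)"
      by (simp add: \<rho>_def F_VX zd_def col_coeff_diff)
    show "VX (x j (Suc k)) = (if \<tau> * \<delta> j \<le> norm (F (ctrl k) (VX (x j k)) - zd j (ctrl k))
        then VX (x j k) - t j k *\<^sub>R F' (ctrl k) (F (ctrl k) (VX (x j k)) - zd j (ctrl k)) else VX (x j k))"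
    proof -
      have "x j (Suc k) = x j k
          - ((if \<tau> * \<delta> j \<le> residual V K (ctrl k) (yn j) (x j k) then 1 else 0) * s (\<delta> j) (yn j) k) *\<^sub>R
            block_proj (ctrl k) (adjoint (tensor_op V K) (tensor_op V K (x j k) - yn j))"
        unfolding x_def by (simp add: Let_def)
      then show ?thesis
        unfolding residual \<rho>_def[symmetric]
        by (simp add: VX_diff VX_scale gradient t_def flip: \<rho>)
    qed
    show "t j k * (norm (F' (ctrl k) (F (ctrl k) (VX (x j k)) - zd j (ctrl k))))\<^sup>2
        \<le> max \<theta> 0 * (norm (F (ctrl k) (VX (x j k)) - zd j (ctrl k))
           * (norm (F (ctrl k) (VX (x j k)) - zd j (ctrl k)) - \<delta> j))"
      if active: "\<tau> * \<delta> j \<le> norm (F (ctrl k) (VX (x j k)) - zd j (ctrl k))"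
      unfolding \<rho>_def[symmetric] r_def[symmetric]
    proof -
      \<comment> \<open>The denominator in \<open>step_bound\<close> carries
        \<open>n (ctrl k)\<close> to the fourth power and the numerator to the second; the excess is
        the factor in \<open>t\<close>.\<close>
      define g where "g = (norm ((n (ctrl k))\<^sup>2 *\<^sub>R F' (ctrl k) \<rho>))\<^sup>2"
      \<comment> \<open>The residual in \<open>step_bound\<close> has the opposite sign, which the
        squared norm ignores.\<close>
      have col: "col_coeff V (ctrl k) (yn j - tensor_op V K (x j k)) = - \<rho>"
        unfolding \<rho> col_coeff_diff by simp
      have "F' (ctrl k) (- \<rho>) = - F' (ctrl k) \<rho>"
        using F'_diff[of "ctrl k" 0 \<rho>] by (simp add: F'_zero)
      then have "(norm (VX (block_proj (ctrl k) (adjoint (tensor_op V K) (yn j - tensor_op V K (x j k))))))\<^sup>2 = g"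
        unfolding gradient col g_def by simp
      then have A: "step_bound V K (ctrl k) (\<delta> j) (yn j) (x j k)
          = (if g = 0 then \<infinity> else ereal ((n (ctrl k))\<^sup>2 * (r * (r - \<delta> j)) / g))"
        unfolding step_bound_def VX_def[symmetric] residual \<rho>_def[symmetric] r_def[symmetric] n_def[symmetric]
        by (simp only: Let_def)
      have "\<delta> j \<le> \<tau> * \<delta> j" using assms(6) assms(9)[of j] by simp
      then have "\<delta> j \<le> r" using active by (simp add: r_def \<rho>_def)
      then have "0 \<le> (n (ctrl k))\<^sup>2 * (r * (r - \<delta> j))" by (simp add: r_def)
      moreover have "0 < s (\<delta> j) (yn j) k \<and>
          ereal (s (\<delta> j) (yn j) k) < 2 * step_bound V K (ctrl k) (\<delta> j) (yn j) (x j k) \<and>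
          ereal (s (\<delta> j) (yn j) k) / step_bound V K (ctrl k) (\<delta> j) (yn j) (x j k) \<le> ereal \<theta>"
        using adm[OF noisy[of j], of k] active unfolding Let_def x_def[symmetric] residual by blast
      ultimately have "s (\<delta> j) (yn j) k * g \<le> max \<theta> 0 * ((n (ctrl k))\<^sup>2 * (r * (r - \<delta> j)))"
        unfolding A by (intro step_size_bound_cases) (auto simp: g_def)
      then have "(n (ctrl k))\<^sup>2 * (t j k * (norm (F' (ctrl k) \<rho>))\<^sup>2)
          \<le> (n (ctrl k))\<^sup>2 * (max \<theta> 0 * (r * (r - \<delta> j)))"
        by (simp add: g_def t_def power_mult_distrib power2_eq_square mult_ac)
      then show "t j k * (norm (F' (ctrl k) \<rho>))\<^sup>2 \<le> max \<theta> 0 * (r * (r - \<delta> j))"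
        using n_pos[of "ctrl k"] by simp
    qed
  qed
  \<comment> \<open>By injectivity the iterates repeat in both variables at the same
    indices.\<close>
  have "VX v = VX w \<longleftrightarrow> v = w" for v w using W by metis
  then have index: "stopping_index p (\<lambda>k. VX (x j k)) = stopping_index p (x j)" for j
    by (simp add: stopping_index_def)
  have "(\<lambda>j. VX (x j (stopping_index p (\<lambda>k. VX (x j k))))) \<longlonglongrightarrow> VX xplus"
    by (rule stopped_iterates_converge[OF loping assms(9,10) _ orth]) (simp_all add: x_def)
  then have "(\<lambda>j. tensor_op W (\<lambda>x. x) (VX (x j (stopping_index p (x j)))))
      \<longlonglongrightarrow> tensor_op W (\<lambda>x. x) (VX xplus)"
    unfolding index by (rule bounded_linear.tendsto[OF bounded_linear_tensor_op[OF bounded_linear_ident]])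
  then show ?thesis by (simp add: W Let_def xplus_def x_def)
qed

end
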